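(* The Eilenberg-Moore category of the Hausdorff monad $\mathbb H$ on $\mathcal V\text{-}\mathsf{Cat}$ has as its objects the order-complete $\mathcal V$-categories $X=(X,a)$ (with a choice $\alpha:PX\to X$ of suprema such that $\alpha(\{x\})=x$) satisfying $$a\Big(\bigvee A,\,y\Big)=\bigwedge_{x\in A}a(x,y)\quad\text{for all } y\in X,\ A\subseteq X,$$ and its morphisms are the $\mathcal V$-functors preserving the chosen suprema.
   Context: $\mathcal V$ is a commutative unital quantale: a complete lattice with a commutative, associative operation $\otimes$ with neutral element $k$, such that $\otimes$ preserves arbitrary suprema in each variable; it is assumed that $k>\bot$. A $\mathcal V$-category $X=(X,a)$ is a set $X$ with $a:X\times X\to\mathcal V$ satisfying $k\le a(x,x)$ and $a(x,y)\otimes a(y,z)\le a(x,z)$. A $\mathcal V$-functor $f:(X,a)\to(Y,b)$ is a map with $a(x,y)\le b(f(x),f(y))$. The induced (pre)order of $X$ is $x\le y\iff k\le a(x,y)$ (not necessarily antisymmetric); $\mathcal V$-functors are ordered pointwise. $X$ is order-complete if every subset of $X$ has a supremum in the induced (pre)order; $\bigvee A$ denotes such a supremum. The Hausdorff monad $\mathbb H=(H,\{-\},\bigcup)$ has $HX=(PX,h_X)$, with $PX$ the powerset of $X$ and $h_X(A,B)=\bigwedge_{x\in A}\bigvee_{y\in B}a(x,y)$, $Hf(A)=f(A)$, unit $x\mapsto\{x\}$ and multiplication $\mathcal A\mapsto\bigcup\mathcal A$. It is of Kock-Zöberlein type ($H\{-\}_X\le\{-\}_{HX}$); accordingly, objects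 of the Eilenberg-Moore category are described as $\mathcal V$-categories $X$ equipped with a $\mathcal V$-functor $\alpha:HX\to X$ with $\alpha\cdot\{-\}=1_X$ and $1_{HX}\le\{-\}\cdot\alpha$. Morphisms $(X,\alpha)\to(Y,\beta)$ are $\mathcal V$-functors $f:X\to Y$ with $f\cdot\alpha=\beta\cdot Hf$. *)

theory Defs
  imports "HOL-Library.FuncSet"
begin

text \<open>
  The tensor of the quantale is written multiplicatively and its unit \<open>k\<close> is \<open>1\<close>.
  Since the tensor is commutative, preservation of suprema in one variable suffices.
\<close>

class commutative_quantale = complete_lattice + comm_monoid_mult +
  assumes mult_Sup: "x * Sup A = (SUP y\<in>A. x * y)"
begin

lemma Sup_mult: "Sup A * x = (SUP y\<in>A. y * x)"
  by (simp add: mult_Sup mult.commute)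

lemma mult_left_isotone:
  assumes "x \<le> y" shows "z * x \<le> z * y"
proof -
  have "z * y = z * Sup {x, y}" using assms by (simp add: sup_absorb2)
  also have "\<dots> = (SUP u\<in>{x, y}. z * u)" by (rule mult_Sup)
  finally show ?thesis by (simp add: le_iff_sup)
qed

lemma mult_isotone: "x \<le> y \<Longrightarrow> u \<le> v \<Longrightarrow> x * u \<le> y * v"
  by (metis mult.commute mult_left_isotone order_trans)

end

locale V_category =
  fixes X :: "'x set" and a :: "'x \<Rightarrow> 'x \<Rightarrow> 'v::commutative_quantale"
  assumes unit_le: "x \<in> X \<Longrightarrow> 1 \<le> a x x"
    and comp_le: "x \<in> X \<Longrightarrow> y \<in> X \<Longrightarrow> z \<in> X \<Longrightarrow> a x y * a y z \<le> a x z"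

text \<open>
  Maps are represented by extensional functions, so that HOL equality is equality of maps.
\<close>

definition V_functor ::
  "'x set \<Rightarrow> ('x \<Rightarrow> 'x \<Rightarrow> 'v::commutative_quantale) \<Rightarrow> 'y set \<Rightarrow> ('y \<Rightarrow> 'y \<Rightarrow> 'v) \<Rightarrow> ('x \<Rightarrow> 'y) \<Rightarrow> bool"
  where "V_functor X a Y b f \<longleftrightarrow>
    f \<in> X \<rightarrow>\<^sub>E Y \<and> (\<forall>x\<in>X. \<forall>y\<in>X. a x y \<le> b (f x) (f y))"

definition ind_le :: "('x \<Rightarrow> 'x \<Rightarrow> 'v::commutative_quantale) \<Rightarrow> 'x \<Rightarrow> 'x \<Rightarrow> bool"
  where "ind_le a x y \<longleftrightarrow> 1 \<le> a x y"

definition map_le ::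
  "'x set \<Rightarrow> ('y \<Rightarrow> 'y \<Rightarrow> 'v::commutative_quantale) \<Rightarrow> ('x \<Rightarrow> 'y) \<Rightarrow> ('x \<Rightarrow> 'y) \<Rightarrow> bool"
  where "map_le X b f g \<longleftrightarrow> (\<forall>x\<in>X. ind_le b (f x) (g x))"

definition is_sup ::
  "'x set \<Rightarrow> ('x \<Rightarrow> 'x \<Rightarrow> 'v::commutative_quantale) \<Rightarrow> 'x set \<Rightarrow> 'x \<Rightarrow> bool"
  where "is_sup X a A s \<longleftrightarrow> s \<in> X \<and> (\<forall>x\<in>A. ind_le a x s) \<and>
    (\<forall>u\<in>X. (\<forall>x\<in>A. ind_le a x u) \<longrightarrow> ind_le a s u)"

definition order_complete :: "'x set \<Rightarrow> ('x \<Rightarrow> 'x \<Rightarrow> 'v::commutative_quantale) \<Rightarrow> bool"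
  where "order_complete X a \<longleftrightarrow> (\<forall>A\<subseteq>X. \<exists>s. is_sup X a A s)"

definition sup_choice ::
  "'x set \<Rightarrow> ('x \<Rightarrow> 'x \<Rightarrow> 'v::commutative_quantale) \<Rightarrow> ('x set \<Rightarrow> 'x) \<Rightarrow> bool"
  where "sup_choice X a \<alpha> \<longleftrightarrow> \<alpha> \<in> Pow X \<rightarrow>\<^sub>E X \<and>
    (\<forall>A\<subseteq>X. is_sup X a A (\<alpha> A)) \<and> (\<forall>x\<in>X. \<alpha> {x} = x)"


section \<open>The Hausdorff monad\<close>

text \<open>On objects the monad sends \<open>(X, a)\<close> to \<open>(Pow X, H_hom a)\<close>.\<close>

definition H_hom ::
  "('x \<Rightarrow> 'x \<Rightarrow> 'v::commutative_quantale) \<Rightarrow> 'x set \<Rightarrow> 'x set \<Rightarrow> 'v"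
  where "H_hom a A B = (INF x\<in>A. SUP y\<in>B. a x y)"

definition H_map :: "'x set \<Rightarrow> ('x \<Rightarrow> 'y) \<Rightarrow> 'x set \<Rightarrow> 'y set"
  where "H_map X f = (\<lambda>A\<in>Pow X. f ` A)"

definition H_unit :: "'x set \<Rightarrow> 'x \<Rightarrow> 'x set"
  where "H_unit X = (\<lambda>x\<in>X. {x})"

definition H_mult :: "'x set \<Rightarrow> 'x set set \<Rightarrow> 'x set"
  where "H_mult X = (\<lambda>\<A>\<in>Pow (Pow X). \<Union>\<A>)"

lemma H_hom_singleton: "H_hom a {x} {y} = a x y"
  by (simp add: H_hom_def)

lemma V_category_H:
  assumes "V_category X a"
  shows "V_category (Pow X) (H_hom a)"
proof
  fix A assume A: "A \<in> Pow X"
  have "1 \<le> (SUP y\<in>A. a x y)" if "x \<in> A" for x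
    using that A V_category.unit_le[OF assms, of x] by (auto intro: SUP_upper2)
  then show "1 \<le> H_hom a A A"
    unfolding H_hom_def by (auto intro: INF_greatest)
next
  fix A B C assume sub: "A \<in> Pow X" "B \<in> Pow X" "C \<in> Pow X"
  show "H_hom a A B * H_hom a B C \<le> H_hom a A C"
  proof (subst (3) H_hom_def, rule INF_greatest)
    fix x assume x: "x \<in> A"
    have "H_hom a A B * H_hom a B C \<le> (SUP y\<in>B. a x y) * H_hom a B C"
      unfolding H_hom_def using x by (intro mult_isotone INF_lower order_refl)
    also have "\<dots> = (SUP y\<in>B. a x y * H_hom a B C)"
      by (simp add: Sup_mult image_image)
    also have "\<dots> \<le> (SUP z\<in>C. a x z)"
    proof (rule SUP_least)
      fix y assume y: "y \<in> B"
      have "a x y * H_hom a B C \<le> a x y * (SUP z\<in>C. a y z)"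
        unfolding H_hom_def using y by (intro mult_left_isotone INF_lower)
      also have "\<dots> = (SUP z\<in>C. a x y * a y z)"
        by (simp add: mult_Sup image_image)
      also have "\<dots> \<le> (SUP z\<in>C. a x z)"
        using x y sub by (intro SUP_mono) (blast intro: V_category.comp_le[OF assms])
      finally show "a x y * H_hom a B C \<le> (SUP z\<in>C. a x z)" .
    qed
    finally show "H_hom a A B * H_hom a B C \<le> (SUP z\<in>C. a x z)" .
  qed
qed

lemma V_functor_H_map:
  assumes "V_functor X a Y b f"
  shows "V_functor (Pow X) (H_hom a) (Pow Y) (H_hom b) (H_map X f)"
proof -
  have "H_hom a A B \<le> H_hom b (f ` A) (f ` B)" if "A \<subseteq> X" "B \<subseteq> X" for A B
  proof -
    have "(SUP y\<in>B. a x y) \<le> (SUP y\<in>B. b (f x) (f y))" if "x \<in> A" for x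
      using that \<open>A \<subseteq> X\<close> \<open>B \<subseteq> X\<close> assms
      by (intro SUP_mono) (meson V_functor_def subsetD)
    then show ?thesis
      unfolding H_hom_def image_image by (intro INF_mono) blast
  qed
  then show ?thesis using assms by (auto simp: V_functor_def H_map_def)
qed

lemma V_functor_H_unit: "V_functor X a (Pow X) (H_hom a) (H_unit X)"
  by (auto simp: V_functor_def H_unit_def H_hom_singleton)

lemma V_functor_H_mult:
  "V_functor (Pow (Pow X)) (H_hom (H_hom a)) (Pow X) (H_hom a) (H_mult X)"
proof -
  have "H_hom (H_hom a) \<A> \<B> \<le> H_hom a (\<Union>\<A>) (\<Union>\<B>)" for \<A> \<B>
    unfolding H_hom_def[of a "\<Union>\<A>"]
  proof (rule INF_greatest)
    fix x assume "x \<in> \<Union>\<A>"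
    then obtain A where A: "A \<in> \<A>" "x \<in> A" by blast
    have "H_hom (H_hom a) \<A> \<B> \<le> (SUP B\<in>\<B>. H_hom a A B)"
      unfolding H_hom_def[of "H_hom a"] using A by (intro INF_lower)
    also have "\<dots> \<le> (SUP y\<in>\<Union>\<B>. a x y)"
    proof (rule SUP_least)
      fix B assume B: "B \<in> \<B>"
      have "H_hom a A B \<le> (SUP y\<in>B. a x y)"
        unfolding H_hom_def using A by (intro INF_lower)
      also have "\<dots> \<le> (SUP y\<in>\<Union>\<B>. a x y)"
        using B by (intro SUP_subset_mono) auto
      finally show "H_hom a A B \<le> (SUP y\<in>\<Union>\<B>. a x y)" .
    qed
    finally show "H_hom (H_hom a) \<A> \<B> \<le> (SUP y\<in>\<Union>\<B>. a x y)" .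
  qed
  then show ?thesis by (auto simp: V_functor_def H_mult_def)
qed

lemma H_monad_laws:
  "compose (Pow X) (H_mult X) (H_unit (Pow X)) = (\<lambda>A\<in>Pow X. A)"
  "compose (Pow X) (H_mult X) (H_map X (H_unit X)) = (\<lambda>A\<in>Pow X. A)"
  "compose (Pow (Pow (Pow X))) (H_mult X) (H_mult (Pow X)) =
   compose (Pow (Pow (Pow X))) (H_mult X) (H_map (Pow (Pow X)) (H_mult X))"
proof -
  show "compose (Pow X) (H_mult X) (H_unit (Pow X)) = (\<lambda>A\<in>Pow X. A)"
    by (rule ext) (auto simp: compose_def H_mult_def H_unit_def)
  have "\<Union> (H_unit X ` A) = A" "H_unit X ` A \<subseteq> Pow X" if "A \<subseteq> X" for A
    using that by (auto simp: H_unit_def)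
  then show "compose (Pow X) (H_mult X) (H_map X (H_unit X)) = (\<lambda>A\<in>Pow X. A)"
    by (intro ext) (simp add: compose_def H_mult_def H_map_def restrict_def)
  have "\<Union> (H_mult X ` \<AA>) = \<Union> (\<Union> \<AA>)" "H_mult X ` \<AA> \<subseteq> Pow X" "\<Union> \<AA> \<subseteq> Pow X"
    if "\<AA> \<subseteq> Pow (Pow X)" for \<AA>
  proof -
    have "H_mult X \<A> = \<Union> \<A>" if "\<A> \<in> \<AA>" for \<A>
      using that \<open>\<AA> \<subseteq> Pow (Pow X)\<close> by (auto simp: H_mult_def)
    then have "H_mult X ` \<AA> = Union ` \<AA>" by (intro image_cong) auto
    then show "\<Union> (H_mult X ` \<AA>) = \<Union> (\<Union> \<AA>)" by auto
    show "\<Union> \<AA> \<subseteq> Pow X" using that by blast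
    then show "H_mult X ` \<AA> \<subseteq> Pow X" unfolding \<open>H_mult X ` \<AA> = Union ` \<AA>\<close> by auto
  qed
  then show "compose (Pow (Pow (Pow X))) (H_mult X) (H_mult (Pow X)) =
      compose (Pow (Pow (Pow X))) (H_mult X) (H_map (Pow (Pow X)) (H_mult X))"
    by (intro ext) (simp add: compose_def H_map_def H_mult_def[of "Pow X"] H_mult_def[of X] restrict_def)
qed

lemma H_unit_natural:
  assumes "f \<in> X \<rightarrow>\<^sub>E Y"
  shows "compose X (H_map X f) (H_unit X) = compose X (H_unit Y) f"
proof
  fix x show "compose X (H_map X f) (H_unit X) x = compose X (H_unit Y) f x"
    using assms by (cases "x \<in> X") (auto simp: compose_def H_unit_def H_map_def)
qed

lemma H_mult_natural:
  assumes "f \<in> X \<rightarrow>\<^sub>E Y"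
  shows "compose (Pow (Pow X)) (H_map X f) (H_mult X) =
    compose (Pow (Pow X)) (H_mult Y) (H_map (Pow X) (H_map X f))"
proof
  fix \<A>
  show "compose (Pow (Pow X)) (H_map X f) (H_mult X) \<A> =
    compose (Pow (Pow X)) (H_mult Y) (H_map (Pow X) (H_map X f)) \<A>"
  proof (cases "\<A> \<subseteq> Pow X")
    case True
    then have "\<Union> \<A> \<subseteq> X" by blast
    have im: "H_map X f ` \<A> = image f ` \<A>"
      using True by (intro image_cong) (auto simp: H_map_def)
    have "image f ` \<A> \<subseteq> Pow Y" using True assms by blast
    then show ?thesis
      using True \<open>\<Union> \<A> \<subseteq> X\<close>
      by (simp add: compose_def H_mult_def im H_map_def[of "Pow X"])
        (simp add: H_map_def image_Union)
  qed (simp add: compose_def)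
qed

lemma H_Kock_Zoeberlein:
  assumes "V_category X a"
  shows "map_le (Pow X) (H_hom (H_hom a)) (H_map X (H_unit X)) (H_unit (Pow X))"
  unfolding map_le_def
proof
  fix A assume A: "A \<in> Pow X"
  have "1 \<le> H_hom a {x} A" if "x \<in> A" for x
    using that A V_category.unit_le[OF assms, of x]
    by (auto simp: H_hom_def intro: SUP_upper2)
  then have "1 \<le> H_hom (H_hom a) ((\<lambda>x. {x}) ` A) {A}"
    unfolding H_hom_def[of "H_hom a"] by (auto intro!: INF_greatest)
  moreover have "H_unit X ` A = (\<lambda>x. {x}) ` A"
    using A by (intro image_cong) (auto simp: H_unit_def)
  ultimately show "ind_le (H_hom (H_hom a)) (H_map X (H_unit X) A) (H_unit (Pow X) A)"
    using A by (simp add: ind_le_def H_map_def H_unit_def[of "Pow X"])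
qed


section \<open>The Eilenberg--Moore category\<close>

text \<open>
  As usual for monads of Kock--Zoeberlein type, an algebra structure on \<open>X\<close> is a morphism
  that is a retraction of the unit and left adjoint to it (with respect to the pointwise
  order). As induced orders need not be antisymmetric, the associative law for \<open>\<alpha>\<close> then
  holds only up to order equivalence.
\<close>

definition EM_object ::
  "'x set \<Rightarrow> ('x \<Rightarrow> 'x \<Rightarrow> 'v::commutative_quantale) \<Rightarrow> ('x set \<Rightarrow> 'x) \<Rightarrow> bool"
  where "EM_object X a \<alpha> \<longleftrightarrow> V_category X a \<and>
    V_functor (Pow X) (H_hom a) X a \<alpha> \<and>
    compose X \<alpha> (H_unit X) = (\<lambda>x\<in>X. x) \<and>
    map_le (Pow X) (H_hom a) (\<lambda>A\<in>Pow X. A) (compose (Pow X) (H_unit X) \<alpha>)"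

definition EM_morphism ::
  "'x set \<Rightarrow> ('x \<Rightarrow> 'x \<Rightarrow> 'v::commutative_quantale) \<Rightarrow> ('x set \<Rightarrow> 'x) \<Rightarrow>
   'y set \<Rightarrow> ('y \<Rightarrow> 'y \<Rightarrow> 'v) \<Rightarrow> ('y set \<Rightarrow> 'y) \<Rightarrow> ('x \<Rightarrow> 'y) \<Rightarrow> bool"
  where "EM_morphism X a \<alpha> Y b \<beta> f \<longleftrightarrow> V_functor X a Y b f \<and>
    compose (Pow X) f \<alpha> = compose (Pow X) \<beta> (H_map X f)"

lemma EM_morphism_id:
  assumes "EM_object X a \<alpha>"
  shows "EM_morphism X a \<alpha> X a \<alpha> (\<lambda>x\<in>X. x)"
proof -
  have "(\<lambda>x\<in>X. x) (\<alpha> A) = \<alpha> A" "H_map X (\<lambda>x\<in>X. x) A = A" if "A \<subseteq> X" for A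
    using that assms by (auto simp: EM_object_def V_functor_def H_map_def)
  then show ?thesis
    by (auto simp: EM_morphism_def V_functor_def compose_def intro!: restrict_ext)
qed

lemma EM_morphism_comp:
  assumes "EM_object X a \<alpha>" "EM_morphism X a \<alpha> Y b \<beta> f" "EM_morphism Y b \<beta> Z c \<gamma> g"
  shows "EM_morphism X a \<alpha> Z c \<gamma> (compose X g f)"
proof -
  have f: "f \<in> X \<rightarrow>\<^sub>E Y" "\<And>x y. x \<in> X \<Longrightarrow> y \<in> X \<Longrightarrow> a x y \<le> b (f x) (f y)"
    and g: "g \<in> Y \<rightarrow>\<^sub>E Z" "\<And>x y. x \<in> Y \<Longrightarrow> y \<in> Y \<Longrightarrow> b x y \<le> c (g x) (g y)"
    using assms(2,3) by (auto simp: EM_morphism_def V_functor_def)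
  have "V_functor X a Z c (compose X g f)"
    unfolding V_functor_def
  proof (intro conjI ballI)
    show "compose X g f \<in> X \<rightarrow>\<^sub>E Z" using f(1) g(1) by (auto simp: compose_def)
    fix x y assume "x \<in> X" "y \<in> X"
    moreover from this have "f x \<in> Y" "f y \<in> Y" using f(1) by auto
    ultimately show "a x y \<le> c (compose X g f x) (compose X g f y)"
      using f(2) g(2) by (metis compose_eq order_trans)
  qed
  moreover have "compose X g f (\<alpha> A) = \<gamma> (H_map X (compose X g f) A)" if A: "A \<subseteq> X" for A
  proof -
    have cf: "compose (Pow X) f \<alpha> = compose (Pow X) \<beta> (H_map X f)"
      and cg: "compose (Pow Y) g \<beta> = compose (Pow Y) \<gamma> (H_map Y g)"
      using assms(2,3) by (auto simp: EM_morphism_def)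
    have fA: "f ` A \<subseteq> Y" using A f(1) by auto
    have "\<alpha> A \<in> X" using A assms(1) by (auto simp: EM_object_def V_functor_def)
    moreover have "f (\<alpha> A) = \<beta> (f ` A)"
      using A fun_cong[OF cf, of A] by (simp add: compose_def H_map_def)
    moreover have "g (\<beta> (f ` A)) = \<gamma> (g ` f ` A)"
      using fA fun_cong[OF cg, of "f ` A"] by (simp add: compose_def H_map_def)
    moreover have "compose X g f ` A = g ` f ` A"
      using A unfolding image_image by (intro image_cong) (auto simp: compose_eq)
    ultimately show ?thesis using A by (simp add: H_map_def compose_eq)
  qed
  ultimately show ?thesis
    by (auto simp: EM_morphism_def compose_def[of "Pow X"] intro!: restrict_ext)
qed

end

theory Submission imports Defs begin

text \<open>
  The hom of \<open>H X\<close> into a singleton is a meet of homs of \<open>X\<close>: \<open>H_hom a A {y} = (INF x\<in>A. a x y)\<close>.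
  Hence a retraction \<open>\<alpha>\<close> of the unit is a \<open>V\<close>-functor left adjoint to it exactly when
  \<open>a (\<alpha> A) y = (INF x\<in>A. a x y)\<close> (lemma \<open>EM_object_iff_hom_eq_INF\<close>). Functoriality of \<open>\<alpha>\<close>
  at the pair \<open>A\<close>, \<open>{y}\<close> gives one inequality and \<open>1 \<le> H_hom a A {\<alpha> A}\<close> the other;
  conversely, the equation makes \<open>\<alpha> A\<close> an upper bound of \<open>A\<close>, and \<open>\<alpha>\<close> a \<open>V\<close>-functor, since
  \<open>a x y \<le> a x (\<alpha> B)\<close> for each \<open>y \<in> B\<close>.

  A point satisfying this equation is a supremum in the induced order
  (\<open>is_sup_if_hom_eq_INF\<close>). Suprema are unique only up to order equivalence, but equivalent
  points have the same homs, so the equation passes from \<open>\<alpha> A\<close> to every supremum of \<open>A\<close>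
  (\<open>hom_eq_INF_of_is_sup\<close>).
\<close>

lemma H_hom_singleton_right: "H_hom a A {y} = (INF x\<in>A. a x y)"
  by (simp add: H_hom_def)

context V_category
begin

lemma hom_antimono_left:
  assumes "x \<in> X" "y \<in> X" "z \<in> X" and "ind_le a x y"
  shows "a y z \<le> a x z"
proof -
  have "1 * a y z \<le> a x y * a y z"
    using assms(4) by (intro mult_isotone) (simp_all add: ind_le_def)
  also have "\<dots> \<le> a x z" using assms by (intro comp_le)
  finally show ?thesis by simp
qed

lemma hom_mono_right:
  assumes "x \<in> X" "y \<in> X" "z \<in> X" and "ind_le a y z"
  shows "a x y \<le> a x z"
proof -
  have "a x y * 1 \<le> a x y * a y z"
    using assms(4) by (intro mult_isotone) (simp_all add: ind_le_def)
  also have "\<dots> \<le> a x z" using assms by (intro comp_le)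
  finally show ?thesis by simp
qed

lemma is_sup_if_hom_eq_INF:
  assumes "s \<in> X" and eq: "\<And>y. y \<in> X \<Longrightarrow> a s y = (INF x\<in>A. a x y)"
  shows "is_sup X a A s"
  using eq unit_le[OF \<open>s \<in> X\<close>] \<open>s \<in> X\<close>
  by (simp add: is_sup_def ind_le_def le_INF_iff)

lemma hom_eq_INF_of_is_sup:
  assumes "A \<subseteq> X" and s: "is_sup X a A s"
    and "t \<in> X" and eq: "\<And>y. y \<in> X \<Longrightarrow> a t y = (INF x\<in>A. a x y)"
    and "y \<in> X"
  shows "a s y = (INF x\<in>A. a x y)"
proof -
  have "is_sup X a A t" using assms by (intro is_sup_if_hom_eq_INF)
  then have "ind_le a s t" "ind_le a t s" "s \<in> X" using s by (auto simp: is_sup_def)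
  then have "a s y = a t y"
    using \<open>t \<in> X\<close> \<open>y \<in> X\<close> by (intro order_antisym hom_antimono_left)
  then show ?thesis using eq[OF \<open>y \<in> X\<close>] by simp
qed

lemma EM_object_hom_eq_INF:
  assumes EM: "EM_object X a \<alpha>" and A: "A \<subseteq> X" and y: "y \<in> X"
  shows "a (\<alpha> A) y = (INF x\<in>A. a x y)"
proof (rule order_antisym)
  have in_X: "\<alpha> A \<in> X" using EM A by (auto simp: EM_object_def V_functor_def)
  have "ind_le (H_hom a) ((\<lambda>A\<in>Pow X. A) A) (compose (Pow X) (H_unit X) \<alpha> A)"
    using EM A unfolding EM_object_def map_le_def by blast
  then have "1 \<le> H_hom a A {\<alpha> A}"
    using A in_X by (simp add: ind_le_def compose_eq H_unit_def)
  then have "ind_le a x (\<alpha> A)" if "x \<in> A" for x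
    using that by (simp add: ind_le_def H_hom_singleton_right le_INF_iff)
  then show "a (\<alpha> A) y \<le> (INF x\<in>A. a x y)"
    using A y in_X by (auto intro!: INF_greatest hom_antimono_left)
  have "\<alpha> {y} = y"
    using EM y by (auto simp: EM_object_def compose_def H_unit_def dest: fun_cong[of _ _ y])
  moreover have "H_hom a A {y} \<le> a (\<alpha> A) (\<alpha> {y})"
    using EM A y by (auto simp: EM_object_def V_functor_def)
  ultimately show "(INF x\<in>A. a x y) \<le> a (\<alpha> A) y"
    by (simp add: H_hom_singleton_right)
qed

lemma EM_object_if_hom_eq_INF:
  assumes \<alpha>: "\<alpha> \<in> Pow X \<rightarrow>\<^sub>E X" "\<And>x. x \<in> X \<Longrightarrow> \<alpha> {x} = x"
    and eq: "\<And>A y. A \<subseteq> X \<Longrightarrow> y \<in> X \<Longrightarrow> a (\<alpha> A) y = (INF x\<in>A. a x y)"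
  shows "EM_object X a \<alpha>"
proof -
  have in_X: "\<alpha> A \<in> X" if "A \<subseteq> X" for A using \<alpha>(1) that by auto
  have ub: "ind_le a x (\<alpha> A)" if "A \<subseteq> X" "x \<in> A" for A x
    using is_sup_if_hom_eq_INF[OF in_X eq, of A] that by (auto simp: is_sup_def)
  have "H_hom a A B \<le> a (\<alpha> A) (\<alpha> B)" if "A \<subseteq> X" "B \<subseteq> X" for A B
  proof -
    have "(SUP y\<in>B. a x y) \<le> a x (\<alpha> B)" if "x \<in> A" for x
      using that \<open>A \<subseteq> X\<close> \<open>B \<subseteq> X\<close> in_X ub by (auto intro!: SUP_least hom_mono_right)
    then show ?thesis
      using that in_X by (auto simp: eq H_hom_def intro!: INF_mono)
  qed
  then have "V_functor (Pow X) (H_hom a) X a \<alpha>"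
    using \<alpha>(1) by (simp add: V_functor_def)
  moreover have "compose X \<alpha> (H_unit X) = (\<lambda>x\<in>X. x)"
    using \<alpha>(2) by (auto simp: compose_def H_unit_def intro!: restrict_ext)
  moreover have "1 \<le> H_hom a A {\<alpha> A}" if "A \<subseteq> X" for A
    using ub[OF that] by (simp add: H_hom_singleton_right le_INF_iff ind_le_def)
  then have "map_le (Pow X) (H_hom a) (\<lambda>A\<in>Pow X. A) (compose (Pow X) (H_unit X) \<alpha>)"
    using in_X by (simp add: map_le_def ind_le_def compose_eq H_unit_def)
  ultimately show ?thesis
    using V_category_axioms by (simp add: EM_object_def)
qed

end

lemma EM_object_iff_hom_eq_INF:
  "EM_object X a \<alpha> \<longleftrightarrow>
    V_category X a \<and> \<alpha> \<in> Pow X \<rightarrow>\<^sub>E X \<and> (\<forall>x\<in>X. \<alpha> {x} = x) \<and>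
    (\<forall>A\<subseteq>X. \<forall>y\<in>X. a (\<alpha> A) y = (INF x\<in>A. a x y))" (is "?L \<longleftrightarrow> ?R")
proof
  assume EM: ?L
  then have "\<alpha> {x} = x" if "x \<in> X" for x
    using that by (auto simp: EM_object_def compose_def H_unit_def dest: fun_cong[of _ _ x])
  with EM show ?R
    using V_category.EM_object_hom_eq_INF[of X a \<alpha>]
    by (auto simp: EM_object_def V_functor_def)
next
  assume ?R
  then show ?L using V_category.EM_object_if_hom_eq_INF[of X a \<alpha>] by simp
qed

lemma EM_object_iff_sup_choice:
  "EM_object X a \<alpha> \<longleftrightarrow>
    V_category X a \<and> order_complete X a \<and> sup_choice X a \<alpha> \<and>
    (\<forall>A\<subseteq>X. \<forall>s. is_sup X a A s \<longrightarrow> (\<forall>y\<in>X. a s y = (INF x\<in>A. a x y)))" (is "?L \<longleftrightarrow> ?R")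
proof
  assume ?L
  then have V: "V_category X a" and \<alpha>: "\<alpha> \<in> Pow X \<rightarrow>\<^sub>E X" "\<forall>x\<in>X. \<alpha> {x} = x"
    and eq: "\<And>A y. A \<subseteq> X \<Longrightarrow> y \<in> X \<Longrightarrow> a (\<alpha> A) y = (INF x\<in>A. a x y)"
    by (simp_all add: EM_object_iff_hom_eq_INF)
  have in_X: "\<alpha> A \<in> X" if "A \<subseteq> X" for A using \<alpha>(1) that by auto
  have sup: "is_sup X a A (\<alpha> A)" if "A \<subseteq> X" for A
    using that by (intro V_category.is_sup_if_hom_eq_INF[OF V] in_X eq)
  have "a s y = (INF x\<in>A. a x y)" if "A \<subseteq> X" "is_sup X a A s" "y \<in> X" for A s y
    using V_category.hom_eq_INF_of_is_sup[OF V that(1,2) in_X eq that(3)] that(1) by blast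
  moreover have "order_complete X a" using sup unfolding order_complete_def by blast
  moreover have "sup_choice X a \<alpha>" using \<alpha> sup by (simp add: sup_choice_def)
  ultimately show ?R using V by simp
next
  assume ?R
  then show ?L by (simp add: EM_object_iff_hom_eq_INF sup_choice_def)
qed

lemma EM_morphism_iff:
  "EM_morphism X a \<alpha> Y b \<beta> f \<longleftrightarrow>
    V_functor X a Y b f \<and> (\<forall>A\<subseteq>X. f (\<alpha> A) = \<beta> (f ` A))"
  by (auto simp: EM_morphism_def compose_def H_map_def fun_eq_iff restrict_def)

theorem corollary1:
  fixes X :: "'x set" and a :: "'x \<Rightarrow> 'x \<Rightarrow> 'v::commutative_quantale" and \<alpha> :: "'x set \<Rightarrow> 'x"
    and Y :: "'y set" and b :: "'y \<Rightarrow> 'y \<Rightarrow> 'v" and \<beta> :: "'y set \<Rightarrow> 'y"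
  assumes "(bot :: 'v) < 1"
  shows "(EM_object X a \<alpha> \<longleftrightarrow>
           V_category X a \<and> order_complete X a \<and> sup_choice X a \<alpha> \<and>
           (\<forall>A\<subseteq>X. \<forall>s. is_sup X a A s \<longrightarrow> (\<forall>y\<in>X. a s y = (INF x\<in>A. a x y)))) \<and>
         (EM_object X a \<alpha> \<and> EM_object Y b \<beta> \<longrightarrow>
           (\<forall>f. EM_morphism X a \<alpha> Y b \<beta> f \<longleftrightarrow>
             V_functor X a Y b f \<and> (\<forall>A\<subseteq>X. f (\<alpha> A) = \<beta> (f ` A))))"
  by (simp add: EM_object_iff_sup_choice EM_morphism_iff)

end
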